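(* Let $\phi \colon M \to N$ be a homomorphism between Puiseux monoids. Then the following conditions hold. (1) There exists $q \in \mathbb{Q}_{\ge 0}$ such that $\phi(x) = qx$ for all $x \in M$, i.e., $\phi$ is given by rational multiplication. (2) The homomorphism $\phi$ is a transfer homomorphism if and only if it is surjective.
   Context: A monoid is a commutative cancellative semigroup with identity; $M^\times$ denotes the set of units (invertible elements) of a monoid $M$. A Puiseux monoid is an additive submonoid of $\mathbb{Q}_{\ge 0}$. A monoid homomorphism $\theta \colon M \to N$ (monoids written multiplicatively) is a transfer homomorphism if: (T1) $N = \theta(M) N^\times$ and $\theta^{-1}(N^\times) = M^\times$; (T2) if $\theta(a) = b_1 b_2$ for $a \in M$ and $b_1, b_2 \in N$, then there exist $a_1, a_2 \in M$ such that $a = a_1 a_2$ and $\theta(a_i) = b_i$ for $i \in \{1,2\}$.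
   Formalization: Part (2) is stated under the assumption that M is trivial whenever N = {0}: for nontrivial M and N = {0} the zero map is surjective but not a transfer homomorphism, since the preimage of the units of N is M, not the units of M. *)

theory Defs
  imports Complex_Main "HOL-Algebra.Coset" "HOL-Algebra.Divisibility"
begin

text \<open>
  Monoids here are commutative and cancellative, i.e. structures satisfying
  \<^locale>\<open>comm_monoid_cancel\<close>. The constant \<^const>\<open>hom\<close> does not ask for the identity to
  be preserved, so this is required separately.
\<close>

definition monoid_hom :: "('a, 'c) monoid_scheme \<Rightarrow> ('b, 'd) monoid_scheme \<Rightarrow> ('a \<Rightarrow> 'b) \<Rightarrow> bool"
  where "monoid_hom M N \<theta> \<longleftrightarrow> \<theta> \<in> hom M N \<and> \<theta> \<one>\<^bsub>M\<^esub> = \<one>\<^bsub>N\<^esub>"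

text \<open>The first two conjuncts after \<^const>\<open>monoid_hom\<close> are (T1), the last one is (T2).\<close>

definition transfer_hom :: "('a, 'c) monoid_scheme \<Rightarrow> ('b, 'd) monoid_scheme \<Rightarrow> ('a \<Rightarrow> 'b) \<Rightarrow> bool"
  where "transfer_hom M N \<theta> \<longleftrightarrow>
    monoid_hom M N \<theta> \<and>
    carrier N = (\<theta> ` carrier M) <#>\<^bsub>N\<^esub> Units N \<and>
    {a \<in> carrier M. \<theta> a \<in> Units N} = Units M \<and>
    (\<forall>a \<in> carrier M. \<forall>b\<^sub>1 \<in> carrier N. \<forall>b\<^sub>2 \<in> carrier N. \<theta> a = b\<^sub>1 \<otimes>\<^bsub>N\<^esub> b\<^sub>2 \<longrightarrow>
      (\<exists>a\<^sub>1 \<in> carrier M. \<exists>a\<^sub>2 \<in> carrier M. a = a\<^sub>1 \<otimes>\<^bsub>M\<^esub> a\<^sub>2 \<and> \<theta> a\<^sub>1 = b\<^sub>1 \<and> \<theta> a\<^sub>2 = b\<^sub>2))"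

definition add_monoid_on :: "rat set \<Rightarrow> rat monoid"
  where "add_monoid_on A = \<lparr>carrier = A, mult = (+), one = 0\<rparr>"

definition puiseux_monoid :: "rat set \<Rightarrow> bool"
  where "puiseux_monoid M \<longleftrightarrow> submonoid M (add_monoid_on {0..})"

lemma puiseux_monoid_iff:
  "puiseux_monoid M \<longleftrightarrow> 0 \<in> M \<and> (\<forall>x\<in>M. 0 \<le> x) \<and> (\<forall>x\<in>M. \<forall>y\<in>M. x + y \<in> M)"
  by (auto simp: puiseux_monoid_def submonoid_def add_monoid_on_def)

lemma puiseux_monoid_comm_monoid_cancel:
  assumes "puiseux_monoid M"
  shows "comm_monoid_cancel (add_monoid_on M)"
  using assms
  by (intro comm_monoid_cancelI comm_monoidI) (auto simp: puiseux_monoid_iff add_monoid_on_def)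

lemma Units_puiseux_monoid:
  assumes "puiseux_monoid M"
  shows "Units (add_monoid_on M) = {0}"
  using assms
  by (auto simp: puiseux_monoid_iff add_monoid_on_def Units_def add_nonneg_eq_0_iff)

text \<open>
  A surjective homomorphism of Puiseux monoids need not be a transfer homomorphism: the zero
  map from a nontrivial Puiseux monoid onto \<open>{0}\<close> violates \<open>\<theta>\<^sup>-\<^sup>1(N\<^sup>\<times>) = M\<^sup>\<times>\<close>. Hence
  the equivalence of the two notions can only be claimed when this case is excluded.
\<close>

lemma zero_hom_not_transfer_hom:
  assumes "puiseux_monoid M" "M \<noteq> {0}"
  shows "monoid_hom (add_monoid_on M) (add_monoid_on {0}) (\<lambda>_. 0)"
    and "(\<lambda>_. 0) ` M = {0}"
    and "\<not> transfer_hom (add_monoid_on M) (add_monoid_on {0}) (\<lambda>_. 0)"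
proof -
  have "puiseux_monoid {0}" by (simp add: puiseux_monoid_iff)
  note U = Units_puiseux_monoid[OF this] Units_puiseux_monoid[OF assms(1)]
  show "monoid_hom (add_monoid_on M) (add_monoid_on {0}) (\<lambda>_. 0)"
    by (auto simp: monoid_hom_def hom_def add_monoid_on_def)
  show "(\<lambda>_. 0) ` M = {0}" using assms(1) by (auto simp: puiseux_monoid_iff)
  show "\<not> transfer_hom (add_monoid_on M) (add_monoid_on {0}) (\<lambda>_. 0)"
    using assms(2) by (simp add: transfer_hom_def U) (simp add: add_monoid_on_def)
qed

end

theory Submission
  imports Defs
begin

text \<open>
  Any two elements \<open>x \<noteq> 0\<close> and \<open>y\<close> of a Puiseux monoid \<open>M\<close> are commensurable: \<open>b y = a x\<close> for some
  natural numbers \<open>a\<close> and \<open>b > 0\<close>. Both sides are multiples inside \<open>M\<close>, so an additive \<open>\<phi>\<close> gives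
  \<open>b \<phi>(y) = a \<phi>(x)\<close>, that is \<open>\<phi>(y)/y = \<phi>(x)/x\<close> when \<open>y \<noteq> 0\<close>: the ratio \<open>q\<close> of image to argument
  is constant (\<open>puiseux_hom_is_multiplication\<close>).

  For the second part, a Puiseux monoid is reduced, so the first half of (T1) is just surjectivity.
  Conversely, a multiplication by \<open>q \<noteq> 0\<close> is injective, while \<open>q = 0\<close> forces the image \<open>N\<close>, and then
  by assumption \<open>M\<close>, to be trivial. So a surjective \<open>\<phi>\<close> is an isomorphism, and isomorphisms of
  reduced monoids are transfer homomorphisms because they pull back both units and factorizations
  (\<open>puiseux_iso_is_transfer_hom\<close>).
\<close>

lemma monoid_hom_add_monoid_on_iff:
  "monoid_hom (add_monoid_on M) (add_monoid_on N) \<phi> \<longleftrightarrow>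
    \<phi> ` M \<subseteq> N \<and> (\<forall>x\<in>M. \<forall>y\<in>M. \<phi> (x + y) = \<phi> x + \<phi> y) \<and> \<phi> 0 = 0"
  by (auto simp: monoid_hom_def hom_def add_monoid_on_def)

lemma puiseux_hom_of_nat_mult:
  assumes "puiseux_monoid M"
    and "monoid_hom (add_monoid_on M) (add_monoid_on N) \<phi>"
    and "x \<in> M"
  shows "of_nat n * x \<in> M \<and> \<phi> (of_nat n * x) = of_nat n * \<phi> x"
  using assms
  by (induction n) (auto simp: puiseux_monoid_iff monoid_hom_add_monoid_on_iff distrib_right)

lemma nonneg_rat_eq_of_nat_divide:
  fixes r :: rat
  assumes "0 \<le> r"
  obtains a b :: nat where "b \<noteq> 0" and "r = of_nat a / of_nat b"
proof -
  obtain c d where r: "r = Fract c d" and "d > 0"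
    by (cases r) auto
  with assms have "c \<ge> 0"
    by (simp add: zero_le_Fract_iff)
  with r \<open>d > 0\<close> show ?thesis
    by (intro that[of "nat d" "nat c"]) (auto simp: Fract_of_int_quotient)
qed

lemma puiseux_hom_cross_ratio:
  assumes M: "puiseux_monoid M"
    and hom: "monoid_hom (add_monoid_on M) (add_monoid_on N) \<phi>"
    and x: "x \<in> M" "x \<noteq> 0" and y: "y \<in> M"
  shows "\<phi> y = \<phi> x / x * y"
proof -
  have "0 \<le> y / x"
    using M x y by (simp add: puiseux_monoid_iff)
  then obtain a b :: nat where b: "b \<noteq> 0" and ratio: "y / x = of_nat a / of_nat b"
    by (rule nonneg_rat_eq_of_nat_divide)
  have "of_nat b * y = of_nat a * x"
    using ratio b x by (simp add: field_simps)
  then have "of_nat b * \<phi> y = of_nat a * \<phi> x"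
    using puiseux_hom_of_nat_mult[OF M hom] x y by metis
  then have "\<phi> y = of_nat a / of_nat b * \<phi> x"
    using b by (simp add: field_simps)
  then show ?thesis
    by (simp flip: ratio)
qed

lemma puiseux_hom_is_multiplication:
  assumes M: "puiseux_monoid M" and N: "puiseux_monoid N"
    and hom: "monoid_hom (add_monoid_on M) (add_monoid_on N) \<phi>"
  obtains q where "0 \<le> q" and "\<And>x. x \<in> M \<Longrightarrow> \<phi> x = q * x"
proof (cases "M = {0}")
  case True
  then show ?thesis
    using hom by (intro that[of 0]) (auto simp: monoid_hom_add_monoid_on_iff)
next
  case False
  then obtain x where x: "x \<in> M" "x \<noteq> 0"
    using M by (auto simp: puiseux_monoid_iff)
  have "0 \<le> \<phi> x / x"
    using M N hom x by (auto simp: puiseux_monoid_iff monoid_hom_add_monoid_on_iff)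
  then show ?thesis
    using puiseux_hom_cross_ratio[OF M hom x] by (rule that)
qed

lemma set_mult_add_monoid_on_zero: "A <#>\<^bsub>add_monoid_on N\<^esub> {0} = A"
  by (simp add: set_mult_def) (simp add: add_monoid_on_def)

lemma puiseux_transfer_hom_surj:
  assumes "puiseux_monoid N"
    and "transfer_hom (add_monoid_on M) (add_monoid_on N) \<phi>"
  shows "\<phi> ` M = N"
  using assms(2)
  unfolding transfer_hom_def Units_puiseux_monoid[OF assms(1)] set_mult_add_monoid_on_zero
  by (simp add: add_monoid_on_def)

text \<open>
  A splitting \<open>\<phi>(a) = b\<^sub>1 + b\<^sub>2\<close> lifts by choosing any preimages of \<open>b\<^sub>1\<close> and \<open>b\<^sub>2\<close>: injectivity
  forces their sum to be \<open>a\<close>.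
\<close>

lemma puiseux_iso_is_transfer_hom:
  assumes M: "puiseux_monoid M" and N: "puiseux_monoid N"
    and hom: "monoid_hom (add_monoid_on M) (add_monoid_on N) \<phi>"
    and inj: "inj_on \<phi> M" and surj: "\<phi> ` M = N"
  shows "transfer_hom (add_monoid_on M) (add_monoid_on N) \<phi>"
proof -
  have M0: "0 \<in> M" and M_add: "\<And>x y. x \<in> M \<Longrightarrow> y \<in> M \<Longrightarrow> x + y \<in> M"
    using M by (auto simp: puiseux_monoid_iff)
  have \<phi>0: "\<phi> 0 = 0" and \<phi>_add: "\<And>x y. x \<in> M \<Longrightarrow> y \<in> M \<Longrightarrow> \<phi> (x + y) = \<phi> x + \<phi> y"
    using hom by (auto simp: monoid_hom_add_monoid_on_iff)
  have kernel: "{a \<in> M. \<phi> a = 0} = {0}"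
    using M0 \<phi>0 inj by (auto dest: inj_onD[of \<phi> M _ 0])
  have split: "\<exists>a\<^sub>1\<in>M. \<exists>a\<^sub>2\<in>M. a = a\<^sub>1 + a\<^sub>2 \<and> \<phi> a\<^sub>1 = b\<^sub>1 \<and> \<phi> a\<^sub>2 = b\<^sub>2"
    if a: "a \<in> M" and b: "b\<^sub>1 \<in> N" "b\<^sub>2 \<in> N" and sum: "\<phi> a = b\<^sub>1 + b\<^sub>2" for a b\<^sub>1 b\<^sub>2
  proof -
    obtain a\<^sub>1 a\<^sub>2 where a\<^sub>1: "a\<^sub>1 \<in> M" "\<phi> a\<^sub>1 = b\<^sub>1" and a\<^sub>2: "a\<^sub>2 \<in> M" "\<phi> a\<^sub>2 = b\<^sub>2"
      using b surj by blast
    then have "\<phi> a = \<phi> (a\<^sub>1 + a\<^sub>2)"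
      using sum \<phi>_add by simp
    then have "a = a\<^sub>1 + a\<^sub>2"
      using inj a a\<^sub>1 a\<^sub>2 M_add by (auto dest: inj_onD)
    then show ?thesis
      using a\<^sub>1 a\<^sub>2 by blast
  qed
  show ?thesis
    unfolding transfer_hom_def Units_puiseux_monoid[OF M] Units_puiseux_monoid[OF N]
      set_mult_add_monoid_on_zero
    using hom surj kernel split by (simp add: add_monoid_on_def)
qed

theorem proposition3p2:
  fixes M N :: "rat set" and \<phi> :: "rat \<Rightarrow> rat"
  assumes "puiseux_monoid M" and "puiseux_monoid N"
    and "monoid_hom (add_monoid_on M) (add_monoid_on N) \<phi>"
  shows "(\<exists>q::rat. 0 \<le> q \<and> (\<forall>x\<in>M. \<phi> x = q * x)) \<and>
    ((N = {0} \<longrightarrow> M = {0}) \<longrightarrow>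
      (transfer_hom (add_monoid_on M) (add_monoid_on N) \<phi> \<longleftrightarrow> \<phi> ` M = N))"
proof -
  obtain q where q: "0 \<le> q" "\<And>x. x \<in> M \<Longrightarrow> \<phi> x = q * x"
    using puiseux_hom_is_multiplication[OF assms] by blast
  have "transfer_hom (add_monoid_on M) (add_monoid_on N) \<phi>"
    if nontrivial: "N = {0} \<longrightarrow> M = {0}" and surj: "\<phi> ` M = N"
  proof -
    have "inj_on \<phi> M"
    proof (cases "q = 0")
      case True
      then have "N = {0}"
        using surj q(2) assms(2) by (auto simp: puiseux_monoid_iff)
      then show ?thesis
        using nontrivial by simp
    next
      case False
      then show ?thesis
        using q(2) by (auto intro: inj_onI)
    qed
    then show ?thesis
      using assms surj by (intro puiseux_iso_is_transfer_hom)
  qed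
  then show ?thesis
    using q puiseux_transfer_hom_surj[OF assms(2)] by blast
qed

end
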